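(* If $G\in\mathcal{G}$, then $$\mathrm{gp}_{\mathrm g}'(G) \le 2 + \max\{|{}_xW_y| : xy\in E(G)\}.$$
   Context: $d_G(u,v)$ is the length of a shortest $u,v$-path in $G$. $\mathcal{G}$ is the set of graphs $G$ such that for any vertices $x,y\in V(G)$ with $d_G(x,y)\ge 2$ there exists an edge $yz$ such that $x$ is equidistant from $y$ and $z$, i.e. $d_G(x,y)=d_G(x,z)$. For an edge $xy\in E(G)$, ${}_xW_y=\{w\in V(G): d_G(x,w)=d_G(y,w)\}$. A set $S\subseteq V(G)$ is in general position if no shortest path of $G$ passes through more than two vertices of $S$. In the Builder-Blocker general position game on $G$, two players, Builder and Blocker, take it in turns to choose (mark) an unmarked vertex of $G$ so that at each stage the set of marked vertices is in general position; the game ends when no further vertex can be selected. Builder aims to make the final set of marked vertices as large as possible, Blocker as small as possible. In the B'-game Blocker moves first. $\mathrm{gp}_{\mathrm g}'(G)$ is the number of vertices in the final set when the B'-game is played optimally by both players. *)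

theory Defs
  imports "Graph_Theory.Graph_Theory" "HOL-Library.Extended_Nat"
begin

text \<open>
  Finite simple graphs are rendered by the locale \<open>graph\<close> (finite, symmetric, loop-free digraphs
  without parallel arcs). Each edge \<open>xy\<close> is represented by both pairs \<open>(x, y)\<close> and \<open>(y, x)\<close> in
  \<open>arcs_ends G\<close>. Connectedness is not required; vertices in different components are at
  distance \<open>\<infinity>\<close>, the infimum of the empty set.
\<close>

definition gdist :: "('a, 'b) pre_digraph \<Rightarrow> 'a \<Rightarrow> 'a \<Rightarrow> enat" where
  "gdist G u v = (INF p\<in>{p. pre_digraph.apath G u p v}. enat (length p))"

definition shortest_path :: "('a, 'b) pre_digraph \<Rightarrow> 'a \<Rightarrow> 'b awalk \<Rightarrow> 'a \<Rightarrow> bool" where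
  "shortest_path G u p v \<longleftrightarrow> pre_digraph.apath G u p v \<and> enat (length p) = gdist G u v"

definition general_position :: "('a, 'b) pre_digraph \<Rightarrow> 'a set \<Rightarrow> bool" where
  "general_position G S \<longleftrightarrow> S \<subseteq> verts G \<and>
     (\<forall>u p v. shortest_path G u p v \<longrightarrow> card (set (pre_digraph.awalk_verts G u p) \<inter> S) \<le> 2)"

definition equidistant_class :: "('a, 'b) pre_digraph set" where
  "equidistant_class = {G. graph G \<and>
     (\<forall>x\<in>verts G. \<forall>y\<in>verts G. gdist G x y \<ge> 2 \<longrightarrow>
        (\<exists>z. (y, z) \<in> arcs_ends G \<and> gdist G x y = gdist G x z))}"

definition equidistant_set :: "('a, 'b) pre_digraph \<Rightarrow> 'a \<Rightarrow> 'a \<Rightarrow> 'a set" where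
  "equidistant_set G x y = {w \<in> verts G. gdist G x w = gdist G y w}"

text \<open>
  The maximum over no edges is taken to be \<open>0\<close>. In \<open>equidistant_class\<close> this concerns only the
  one-vertex graph and the empty graph.
\<close>

definition max_equidistant :: "('a, 'b) pre_digraph \<Rightarrow> nat" where
  "max_equidistant G =
     (if arcs_ends G = {} then 0
      else Max {card (equidistant_set G x y) | x y. (x, y) \<in> arcs_ends G})"

datatype player = Builder | Blocker

definition legal_moves :: "('a, 'b) pre_digraph \<Rightarrow> 'a set \<Rightarrow> 'a set" where
  "legal_moves G S = {v \<in> verts G - S. general_position G (insert v S)}"

text \<open>
  \<open>game_value G P S\<close> is the size of the final marked set under optimal play when \<open>S\<close> is marked and
  player \<open>P\<close> is to move. The test \<open>finite (verts G)\<close> only serves to make the recursion total.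
\<close>

function game_value :: "('a, 'b) pre_digraph \<Rightarrow> player \<Rightarrow> 'a set \<Rightarrow> nat" where
  "game_value G P S =
     (if \<not> finite (verts G) \<or> legal_moves G S = {} then card S
      else case P of
        Builder \<Rightarrow> Max ((\<lambda>v. game_value G Blocker (insert v S)) ` legal_moves G S)
      | Blocker \<Rightarrow> Min ((\<lambda>v. game_value G Builder (insert v S)) ` legal_moves G S))"
  by pat_completeness auto
termination
proof (relation "measure (\<lambda>(G, P, S). card (verts G - S))", goal_cases)
  case 1
  show ?case by simp
next
  case (2 G P S v)
  then show ?case
    by (auto simp: legal_moves_def simp del: card_Diff_insert intro!: psubset_card_mono)
next
  case (3 G P S v)
  then show ?case
    by (auto simp: legal_moves_def simp del: card_Diff_insert intro!: psubset_card_mono)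
qed

declare game_value.simps [simp del]

definition gp_game' :: "('a, 'b) pre_digraph \<Rightarrow> nat" where
  "gp_game' G = game_value G Blocker {}"

end

theory Submission
  imports Defs
begin

text \<open>
  Blocker opens with an arbitrary vertex \<open>x\<close>, and Builder answers with some \<open>y\<close>. If \<open>x\<close> and \<open>y\<close>
  are adjacent, both ends of an edge are already marked. Otherwise \<open>gdist G x y \<ge> 2\<close>, and the
  hypothesis on \<open>G\<close> yields a neighbour \<open>z\<close> of \<open>y\<close> with \<open>gdist G x y = gdist G x z\<close>. Blocker marks
  \<open>z\<close>, which is legal: vertices on a shortest path behave like integers, and two distinct
  integers at the same distance from a third one are never consecutive
  (lemma \<open>general_position_equidistant\<close>). So after at most three moves both ends of an edge \<open>ab\<close>
  are marked, unless the game has stopped earlier with at most two marked vertices.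

  From then on only vertices of \<open>equidistant_set G a b\<close> can be marked. Indeed, the distances from
  \<open>a\<close> and from \<open>b\<close> to a vertex \<open>w\<close> differ by at most one; if they differ, the edge \<open>ab\<close> prolongs
  a shortest path between \<open>w\<close> and the nearer end to a shortest path through \<open>a\<close>, \<open>b\<close> and \<open>w\<close>.
  Hence every set in general position that contains \<open>a\<close> and \<open>b\<close> has at most
  \<open>2 + card (equidistant_set G a b)\<close> elements (lemma \<open>card_general_position_edge\<close>).
\<close>

section \<open>Distances and shortest paths\<close>

text \<open>
  A shortest walk repeats no vertex, since a repetition encloses a closed walk that could be cut
  out. So the infimum over paths can be computed over walks, which may be concatenated freely.
\<close>

lemma (in wf_digraph) gdist_le_iff_awalk:
  "gdist G u v \<le> enat n \<longleftrightarrow> (\<exists>p. awalk u p v \<and> length p \<le> n)"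
proof
  assume le: "gdist G u v \<le> enat n"
  have "\<exists>p\<in>{p. apath u p v}. enat (length p) < enat (Suc n)"
    using le unfolding gdist_def by (subst INF_less_iff[symmetric]) (simp add: le_less_trans)
  then show "\<exists>p. awalk u p v \<and> length p \<le> n"
    by (auto simp: less_Suc_eq_le intro: awalkI_apath)
next
  assume "\<exists>p. awalk u p v \<and> length p \<le> n"
  then obtain p where "awalk u p v" "length p \<le> n" by blast
  then show "gdist G u v \<le> enat n"
  proof (induction "length p" arbitrary: p rule: less_induct)
    case less
    show ?case
    proof (cases "distinct (awalk_verts u p)")
      case True
      then have "gdist G u v \<le> enat (length p)"
        unfolding gdist_def using less.prems(1) by (intro INF_lower) (simp add: apath_def)
      also have "\<dots> \<le> enat n" using less.prems(2) by simp
      finally show ?thesis .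
    next
      case False
      then obtain q r s w where "p = q @ r @ s" "0 < length r" "awalk u q w" "awalk w s v"
        using awalk_not_distinct_decomp[OF less.prems(1)] by blast
      then show ?thesis
        using less.hyps[of "q @ s"] less.prems(2) by auto
    qed
  qed
qed

lemma (in wf_digraph) gdist_le_length: "awalk u p v \<Longrightarrow> gdist G u v \<le> enat (length p)"
  using gdist_le_iff_awalk by blast

lemma (in wf_digraph) shortest_pathI:
  assumes "awalk u p v" "enat (length p) \<le> gdist G u v"
  shows "shortest_path G u p v"
proof -
  have len: "enat (length p) = gdist G u v"
    using assms gdist_le_length by (simp add: antisym)
  have "distinct (awalk_verts u p)"
  proof (rule ccontr)
    assume "\<not> distinct (awalk_verts u p)"
    then obtain q r s w where "p = q @ r @ s" "0 < length r" "awalk u q w" "awalk w s v"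
      using awalk_not_distinct_decomp[OF assms(1)] by blast
    moreover from this have "gdist G u v \<le> enat (length (q @ s))"
      by (intro gdist_le_length) auto
    ultimately show False using len[symmetric] by simp
  qed
  with assms(1) len show ?thesis by (simp add: shortest_path_def apath_def)
qed

lemma (in wf_digraph) gdist_shortest_subwalk:
  assumes "gdist G u v = enat (length (p @ q @ r))"
    and "awalk u p a" "awalk a q b" "awalk b r v"
  shows "gdist G a b = enat (length q)"
proof (rule antisym)
  show "gdist G a b \<le> enat (length q)" using assms(3) by (rule gdist_le_length)
  show "enat (length q) \<le> gdist G a b"
  proof (cases "gdist G a b")
    case (enat n)
    then obtain q' where q': "awalk a q' b" "length q' \<le> n"
      using gdist_le_iff_awalk[of a b n] by auto
    have "awalk u (p @ q' @ r) v" using assms(2,4) q'(1) by auto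
    from gdist_le_length[OF this] show ?thesis using assms(1) q'(2) enat by simp
  qed simp
qed

lemma (in sym_digraph) awalk_reverse:
  assumes "awalk u p v"
  shows "\<exists>q. awalk v q u \<and> length q = length p"
  using assms
proof (induction p arbitrary: u)
  case Nil
  then show ?case by (auto simp: awalk_Nil_iff intro!: exI[of _ "[]"])
next
  case (Cons e p)
  then obtain q where q: "awalk v q (head G e)" "length q = length p"
    by (auto simp: awalk_Cons_iff)
  obtain e' where "e' \<in> arcs G" "tail G e' = head G e" "head G e' = u"
    using Cons.prems sym_arcs by (fastforce simp: awalk_Cons_iff symmetric_conv)
  then have "awalk v (q @ [e']) u"
    using q(1) by (auto simp: awalk_Cons_iff awalk_Nil_iff)
  then show ?case using q(2) by (intro exI[of _ "q @ [e']"]) simp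
qed

lemma (in sym_digraph) gdist_commute: "gdist G u v = gdist G v u"
proof -
  have "gdist G u v \<le> gdist G v u" for u v
  proof (cases "gdist G v u")
    case (enat n)
    then obtain p where "awalk v p u" "length p \<le> n"
      using gdist_le_iff_awalk[of v u n] by auto
    then show ?thesis
      using awalk_reverse[of v p u] gdist_le_iff_awalk[of u v n] enat by auto
  qed simp
  then show ?thesis by (simp add: antisym)
qed

lemma (in wf_digraph) gdist_eq_0D: "gdist G u v = 0 \<Longrightarrow> u = v"
  using gdist_le_iff_awalk[of u v 0] by (auto simp: awalk_Nil_iff zero_enat_def)

lemma (in wf_digraph) gdist_arc_le_1:
  assumes "(u, v) \<in> arcs_ends G"
  shows "gdist G u v \<le> 1"
  using assms gdist_le_length[OF arc_implies_awalk]
  by (auto simp: arcs_ends_conv one_enat_def)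

lemma (in wf_digraph) gdist_le_1D:
  assumes "gdist G u v \<le> 1" "u \<noteq> v"
  shows "(u, v) \<in> arcs_ends G"
proof -
  obtain p where p: "awalk u p v" "length p \<le> 1"
    using assms(1) gdist_le_iff_awalk[of u v 1] by (auto simp: one_enat_def)
  then obtain e where "p = [e]"
    using assms(2) by (cases p) (auto simp: awalk_Nil_iff)
  then show ?thesis using p(1) by (auto simp: arcs_ends_conv awalk_simps)
qed

section \<open>General position\<close>

text \<open>
  The vertices of a shortest path embed isometrically into the integers: the coordinate of a
  vertex is its distance from the start of the path.
\<close>

lemma (in sym_digraph) shortest_path_coordinates:
  assumes "shortest_path G u p v"
  obtains f :: "'a \<Rightarrow> int" where
    "\<And>a b. a \<in> set (awalk_verts u p) \<Longrightarrow> b \<in> set (awalk_verts u p) \<Longrightarrow>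
      gdist G a b = enat (nat \<bar>f a - f b\<bar>)"
proof
  fix a b
  assume "a \<in> set (awalk_verts u p)" "b \<in> set (awalk_verts u p)"
  let ?f = "\<lambda>w. int (the_enat (gdist G u w))"
  have p: "awalk u p v" and len: "gdist G u v = enat (length p)"
    using assms by (auto simp: shortest_path_def intro: awalkI_apath)
  have u: "awalk u [] u" using p by (simp add: awalk_Nil_iff awalk_hd_in_verts)
  have ordered: "gdist G a b = enat (nat \<bar>?f a - ?f b\<bar>)"
    if "p = q @ r @ s" "awalk u q a" "awalk a r b" "awalk b s v" for a b q r s
  proof -
    have "gdist G u a = enat (length q)"
      using gdist_shortest_subwalk[of u v "[]" q "r @ s" u a] that len u by auto
    moreover have "gdist G u b = enat (length (q @ r))"
      using gdist_shortest_subwalk[of u v "[]" "q @ r" s u b] that len u by auto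
    moreover have "gdist G a b = enat (length r)"
      using gdist_shortest_subwalk[of u v q r s a b] that len by auto
    ultimately show ?thesis by simp
  qed
  obtain q r where qr: "p = q @ r" "awalk u q a" "awalk a r v"
    using awalk_decomp[OF p \<open>a \<in> _\<close>] by blast
  then consider "b \<in> set (awalk_verts u q)" | "b \<in> set (awalk_verts a r)"
    using \<open>b \<in> _\<close> set_awalk_verts_append by blast
  then show "gdist G a b = enat (nat \<bar>?f a - ?f b\<bar>)"
  proof cases
    case 1
    then obtain q1 q2 where "q = q1 @ q2" "awalk u q1 b" "awalk b q2 a"
      using awalk_decomp[OF qr(2)] by blast
    then have "gdist G b a = enat (nat \<bar>?f b - ?f a\<bar>)"
      using ordered[of q1 q2 r b a] qr by simp
    then show ?thesis by (simp add: gdist_commute abs_minus_commute)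
  next
    case 2
    then obtain r1 r2 where "r = r1 @ r2" "awalk a r1 b" "awalk b r2 v"
      using awalk_decomp[OF qr(3)] by blast
    then show ?thesis using ordered[of q r1 r2 a b] qr by simp
  qed
qed

lemma general_position_card_le_2:
  assumes "S \<subseteq> verts G" "finite S" "card S \<le> 2"
  shows "general_position G S"
  using assms card_mono[of S] unfolding general_position_def
  by (meson Int_lower2 order_trans)

text \<open>
  If a shortest path contained all three vertices, the integer coordinates of \<open>y\<close> and \<open>z\<close> would
  be equidistant from that of \<open>x\<close>, so their difference would be even, whereas adjacent
  vertices have coordinates that differ by one.
\<close>

lemma (in sym_digraph) general_position_equidistant:
  assumes "{x, y, z} \<subseteq> verts G" "(y, z) \<in> arcs_ends G"
    and "gdist G x y = gdist G x z"
  shows "general_position G {x, y, z}"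
  unfolding general_position_def
proof (intro conjI allI impI)
  show "{x, y, z} \<subseteq> verts G" by fact
  fix u p v
  assume "shortest_path G u p v"
  then obtain f :: "'a \<Rightarrow> int" where f: "\<And>a b. a \<in> set (awalk_verts u p) \<Longrightarrow>
      b \<in> set (awalk_verts u p) \<Longrightarrow> gdist G a b = enat (nat \<bar>f a - f b\<bar>)"
    using shortest_path_coordinates by blast
  show "card (set (awalk_verts u p) \<inter> {x, y, z}) \<le> 2"
  proof (rule ccontr)
    let ?T = "set (awalk_verts u p) \<inter> {x, y, z}"
    assume "\<not> card ?T \<le> 2"
    moreover have "card {x, y, z} \<le> 3" by (simp add: card_insert_if)
    moreover have "card ?T \<le> card {x, y, z}" by (intro card_mono) auto
    ultimately have card3: "card ?T = card {x, y, z}" "card {x, y, z} = 3" by linarith+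
    then have "?T = {x, y, z}" by (intro card_subset_eq) auto
    then have "{x, y, z} \<subseteq> set (awalk_verts u p)" by blast
    then have "gdist G x y = enat (nat \<bar>f x - f y\<bar>)" "gdist G x z = enat (nat \<bar>f x - f z\<bar>)"
      and yz: "gdist G y z = enat (nat \<bar>f y - f z\<bar>)"
      using f by auto
    then have "\<bar>f x - f y\<bar> = \<bar>f x - f z\<bar>" "\<bar>f y - f z\<bar> \<le> 1"
      using assms(3) gdist_arc_le_1[OF assms(2)]
      by (auto simp: one_enat_def eq_nat_nat_iff)
    then have "f y = f z" by presburger
    with yz have "y = z" using gdist_eq_0D by (simp add: zero_enat_def)
    with card3(2) show False by (auto simp: card_insert_if split: if_splits)
  qed
qed

text \<open>
  The arc from \<open>y\<close> to \<open>x\<close> bounds the distance from \<open>y\<close> by one more than that from \<open>x\<close>, so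
  prepending it to a shortest path from the strictly nearer end \<open>x\<close> gives a shortest path again.
\<close>

lemma (in wf_digraph) shortest_path_through_arc:
  assumes "(y, x) \<in> arcs_ends G" "gdist G x w < gdist G y w"
  shows "\<exists>p. shortest_path G y p w \<and> {x, y, w} \<subseteq> set (awalk_verts y p)"
proof -
  obtain n where n: "gdist G x w = enat n" using assms(2) by (cases "gdist G x w") auto
  then obtain p where p: "awalk x p w" "length p \<le> n"
    using gdist_le_iff_awalk[of x w n] by auto
  obtain e where e: "e \<in> arcs G" "tail G e = y" "head G e = x"
    using assms(1) by (auto simp: arcs_ends_conv)
  have "awalk y (e # p) w" using e p(1) by (simp add: awalk_Cons_iff)
  moreover have "enat (length (e # p)) \<le> gdist G y w"
    using p(2) n assms(2) by (cases "gdist G y w") auto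
  moreover have "{x, w} \<subseteq> set (awalk_verts x p)"
    using p(1) hd_in_awalk_verts(1)[of x p w] awlast_of_awalk[of x p w]
      last_in_set[OF awalk_verts_non_Nil, of x p] by auto
  ultimately show ?thesis
    using shortest_pathI e by (intro exI[of _ "e # p"]) auto
qed

lemma (in graph) general_position_edge_equidistant:
  assumes "general_position G S" "(x, y) \<in> arcs_ends G" "{x, y, w} \<subseteq> S" "w \<noteq> x" "w \<noteq> y"
  shows "gdist G x w = gdist G y w"
proof -
  have "x \<noteq> y" using assms(2) no_loops by (auto simp: arcs_ends_conv)
  then have card3: "card {x, y, w} = 3" using assms(4,5) by auto
  have no_path: False if "shortest_path G u p v" "{x, y, w} \<subseteq> set (awalk_verts u p)" for u p v
  proof -
    have "card {x, y, w} \<le> card (set (awalk_verts u p) \<inter> S)"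
      using that(2) assms(3) by (intro card_mono) auto
    with card3 that(1) assms(1) show False by (fastforce simp: general_position_def)
  qed
  have "(y, x) \<in> arcs_ends G" using assms(2) sym_arcs by (simp add: arcs_ends_symmetric)
  then have "\<not> gdist G x w < gdist G y w" "\<not> gdist G y w < gdist G x w"
    using no_path shortest_path_through_arc[of y x w] shortest_path_through_arc[of x y w] assms(2)
    by (metis insert_commute)+
  then show ?thesis by simp
qed

lemma (in graph) card_general_position_edge:
  assumes "general_position G S" "(x, y) \<in> arcs_ends G" "x \<in> S" "y \<in> S"
  shows "card S \<le> 2 + max_equidistant G"
proof -
  let ?M = "{card (equidistant_set G x y) | x y. (x, y) \<in> arcs_ends G}"
  have "S - {x, y} \<subseteq> equidistant_set G x y"
    using assms general_position_edge_equidistant[of S x y]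
    by (auto simp: equidistant_set_def general_position_def)
  then have "S \<subseteq> {x, y} \<union> equidistant_set G x y" by blast
  moreover have "finite (equidistant_set G x y)" by (simp add: equidistant_set_def)
  ultimately have "card S \<le> card ({x, y} \<union> equidistant_set G x y)"
    by (intro card_mono) auto
  also have "\<dots> \<le> card {x, y} + card (equidistant_set G x y)" by (rule card_Un_le)
  also have "\<dots> \<le> 2 + card (equidistant_set G x y)" by (simp add: card_insert_if)
  also have "card (equidistant_set G x y) \<le> Max ?M"
  proof (rule Max_ge)
    have "?M = (\<lambda>(x, y). card (equidistant_set G x y)) ` arcs_ends G" by auto
    then show "finite ?M" by (simp add: arcs_ends_conv)
  qed (use assms(2) in auto)
  also have "Max ?M = max_equidistant G" using assms(2) by (auto simp: max_equidistant_def)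
  finally show ?thesis by simp
qed

section \<open>Bounding the value of the game\<close>

text \<open>
  However the players move, the final set contains \<open>S\<close> and is in general position. So a bound on
  all such sets bounds the value of the game from \<open>S\<close> on, with no analysis of optimal play.
\<close>

lemma game_value_attained:
  assumes "general_position G S"
  shows "\<exists>T. S \<subseteq> T \<and> general_position G T \<and> game_value G P S = card T"
  using assms
proof (induction G P S rule: game_value.induct)
  case (1 G P S)
  show ?case
  proof (cases "\<not> finite (verts G) \<or> legal_moves G S = {}")
    case True
    then have "game_value G P S = card S" by (subst game_value.simps) auto
    then show ?thesis using "1.prems" by blast
  next
    case False
    let ?Q = "case P of Builder \<Rightarrow> Blocker | Blocker \<Rightarrow> Builder"
    let ?V = "(\<lambda>v. game_value G ?Q (insert v S)) ` legal_moves G S"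
    have V: "finite ?V" "?V \<noteq> {}" using False by (auto simp: legal_moves_def)
    have "game_value G P S \<in> ?V"
      using False V Max_in[OF V] Min_in[OF V]
      by (cases P; subst game_value.simps) auto
    then obtain v where v: "v \<in> legal_moves G S" "game_value G P S = game_value G ?Q (insert v S)"
      by blast
    then have "general_position G (insert v S)" by (simp add: legal_moves_def)
    then have "\<exists>T. insert v S \<subseteq> T \<and> general_position G T \<and>
        game_value G ?Q (insert v S) = card T"
      using "1.IH"(1)[OF False _ v(1)] "1.IH"(2)[OF False _ v(1)] by (cases P) auto
    then show ?thesis using v(2) by auto
  qed
qed

lemma game_value_le:
  assumes "general_position G S"
    and "\<And>T. S \<subseteq> T \<Longrightarrow> general_position G T \<Longrightarrow> card T \<le> c"
  shows "game_value G P S \<le> c"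
  using game_value_attained[OF assms(1)] assms(2) by metis

lemma game_value_Blocker_le:
  assumes "finite (verts G)" "v \<in> legal_moves G S" "game_value G Builder (insert v S) \<le> c"
  shows "game_value G Blocker S \<le> c"
proof -
  have "finite (legal_moves G S)" using assms(1) by (simp add: legal_moves_def)
  then have "Min ((\<lambda>v. game_value G Builder (insert v S)) ` legal_moves G S)
      \<le> game_value G Builder (insert v S)"
    using assms(2) by (intro Min_le) auto
  then show ?thesis using assms by (subst game_value.simps) auto
qed

lemma game_value_Builder_le:
  assumes "finite (verts G)" "card S \<le> c"
    and "\<And>v. v \<in> legal_moves G S \<Longrightarrow> game_value G Blocker (insert v S) \<le> c"
  shows "game_value G Builder S \<le> c"
proof -
  have "finite (legal_moves G S)" using assms(1) by (simp add: legal_moves_def)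
  then show ?thesis using assms by (subst game_value.simps) auto
qed

theorem theorem2p5:
  fixes G :: "('a, 'b) pre_digraph"
  assumes "G \<in> equidistant_class"
  shows "gp_game' G \<le> 2 + max_equidistant G"
proof -
  interpret graph G using assms by (simp add: equidistant_class_def)
  let ?c = "2 + max_equidistant G"
  have edge: "game_value G P S \<le> ?c"
    if "general_position G S" "(a, b) \<in> arcs_ends G" "a \<in> S" "b \<in> S" for P S a b
    using that card_general_position_edge by (intro game_value_le) blast+
  have reply: "game_value G Blocker {x, y} \<le> ?c"
    if x: "x \<in> verts G" and y: "y \<in> verts G" and "x \<noteq> y" for x y
  proof (cases "gdist G x y \<le> 1")
    case True
    then have "(x, y) \<in> arcs_ends G" using \<open>x \<noteq> y\<close> gdist_le_1D by blast
    moreover have "general_position G {x, y}"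
      using x y by (intro general_position_card_le_2) (auto simp: card_insert_if)
    ultimately show ?thesis by (intro edge) auto
  next
    case False
    then have far: "2 \<le> gdist G x y"
      by (cases "gdist G x y") (auto simp: numeral_eq_enat one_enat_def)
    then obtain z where z: "(y, z) \<in> arcs_ends G" "gdist G x y = gdist G x z"
      using assms x y unfolding equidistant_class_def by blast
    have "z \<in> verts G" "z \<noteq> y" using z(1) by (auto simp: arcs_ends_conv dest: no_loops)
    have "gdist G x x \<le> 0"
      using x gdist_le_length[of x "[]" x] by (simp add: awalk_Nil_iff zero_enat_def)
    then have "z \<noteq> x" using far z(2) by auto
    have gp: "general_position G {x, y, z}"
      using x y \<open>z \<in> verts G\<close> z by (intro general_position_equidistant) auto
    have "z \<in> legal_moves G {x, y}"
      using \<open>z \<in> verts G\<close> \<open>z \<noteq> x\<close> \<open>z \<noteq> y\<close> gp by (simp add: legal_moves_def insert_commute)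
    moreover have "game_value G Builder (insert z {x, y}) \<le> ?c"
      using gp z(1) by (intro edge) (auto simp: insert_commute)
    ultimately show ?thesis by (intro game_value_Blocker_le) auto
  qed
  show ?thesis
  proof (cases "verts G = {}")
    case True
    then show ?thesis
      by (simp add: gp_game'_def game_value.simps[of G Blocker "{}"] legal_moves_def)
  next
    case False
    then obtain x where x: "x \<in> verts G" by blast
    then have "x \<in> legal_moves G {}"
      by (simp add: legal_moves_def general_position_card_le_2)
    moreover have "game_value G Builder {x} \<le> ?c"
    proof (rule game_value_Builder_le)
      fix y
      assume "y \<in> legal_moves G {x}"
      then have "y \<in> verts G" "x \<noteq> y" by (auto simp: legal_moves_def)
      from reply[OF x this] show "game_value G Blocker (insert y {x}) \<le> ?c"
        by (simp add: insert_commute)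
    qed auto
    ultimately show ?thesis
      unfolding gp_game'_def by (intro game_value_Blocker_le) auto
  qed
qed

end
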